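(* Let $\mathcal{T}$ be a robust tangle of order $k$ in a connectivity system $(E,\lambda)$, and let $\mathcal{S}$ be a tree compatible set. If $\Phi$ is an $\mathcal{S}$-tight $\mathcal{S}$-maximal $k$-flower in $\mathcal{T}$, then every $(k,\mathcal{S})$-separation conforms with $\Phi$.
   Context: A connectivity system is a pair $(E,\lambda)$ with $E$ finite and $\lambda$ integer-valued, symmetric ($\lambda(X)=\lambda(E-X)$) and submodular on subsets of $E$. $X$ is $k$-separating if $\lambda(X)\le k$; a $k$-separation is an unordered partition $(X,E-X)$ with $\lambda(X)\le k$. A robust tangle of order $k$ is a collection $\mathcal T$ of subsets of $E$ with (T1) $\lambda(A)<k$ for $A\in\mathcal T$; (T2) if $\lambda(A)\le k-1$ then $A\in\mathcal T$ or $E-A\in\mathcal T$; (RT3) no eight members of $\mathcal T$ have union $E$; (T4) $E-\{e\}\notin\mathcal T$ for $e\in E$. A set is $\mathcal T$-weak if contained in a member of $\mathcal T$, otherwise $\mathcal T$-strong; a partition/$k$-separation is $\mathcal T$-strong if all parts are. A $\mathcal T$-strong $k$-separating $X$ is fully closed if $X\cup Y$ is not $k$-separating for all nonempty $\mathcal T$-weak $Y\subseteq E-X$; $\mathrm{fcl}_{\mathcal T}(X)$ is the intersection of all fully closed $k$-separating sets containing $X$. $\mathcal T$-strong $k$-separations $(X,Y),(X',Y')$ are $\mathcal T$-equivalent if $\{\mathrm{fcl}_{\mathcal T}(X),\mathrm{fcl}_{\mathcal T}(Y)\}=\{\mathrm{fcl}_{\mathcal T}(X'),\mathrm{fcl}_{\mathcal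 T}(Y')\}$. A $k$-separating $X$ is $\mathcal T$-sequential if $E-X$ is $\mathcal T$-strong and $\mathrm{fcl}_{\mathcal T}(E-X)=E$. Let $\mathcal S$ be a set of non-$\mathcal T$-sequential $k$-separating sets with $\mathcal T$-strong complements; a $(k,\mathcal S)$-separation is a $k$-separation $(X,E-X)$ with $X,E-X\in\mathcal S$. $\mathcal S$ is tree compatible if (S1) any $\mathcal T$-strong $k$-separation $\mathcal T$-equivalent to a $(k,\mathcal S)$-separation is a $(k,\mathcal S)$-separation and (S2) if $X\in\mathcal S$ and $(Y,E-Y)$ is a $\mathcal T$-strong $k$-separation with $X\subseteq Y$ then $Y\in\mathcal S$. A $k$-flower in $\mathcal T$ is a $\mathcal T$-strong partition $(P_1,\dots,P_n)$ of $E$ with $P_i$ and $P_i\cup P_{i+1}$ $k$-separating for all $i$ (indices mod $n$); it displays $(X,E-X)$ if $X$ is a union of petals. $\Phi_1\preccurlyeq_{\mathcal S}\Phi_2$ if every $(k,\mathcal S)$-separation displayed by $\Phi_1$ is $\mathcal T$-equivalent to some $(k,\mathcal S)$-separation displayed by $\Phi_2$; they are equivalent if both hold. $\Phi$ is $\mathcal S$-tight if it is not equivalent to a $k$-flower with fewer petals, and $\mathcal S$-maximal if $\Phi\preccurlyeq_{\mathcal S}\Phi'$ implies $\Phi'\preccurlyeq_{\mathcal S}\Phi$. A $\mathcal T$-strong $k$-separation $(R,G)$ conforms with $\Phi$ if it is $\mathcal T$-equivalent to a $k$-separation displayed by $\Phi$, or to a $k$-separation $(R',G')$ with $R'$ or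 $G'$ contained in a petal of $\Phi$. *)

theory Defs
  imports Main
begin

definition connectivity_system :: "'a set \<Rightarrow> ('a set \<Rightarrow> int) \<Rightarrow> bool" where
  "connectivity_system E lam \<longleftrightarrow> finite E
     \<and> (\<forall>X. X \<subseteq> E \<longrightarrow> lam X = lam (E - X))
     \<and> (\<forall>X Y. X \<subseteq> E \<longrightarrow> Y \<subseteq> E \<longrightarrow> lam (X \<union> Y) + lam (X \<inter> Y) \<le> lam X + lam Y)"

definition k_separating :: "'a set \<Rightarrow> ('a set \<Rightarrow> int) \<Rightarrow> int \<Rightarrow> 'a set \<Rightarrow> bool" where
  "k_separating E lam k X \<longleftrightarrow> X \<subseteq> E \<and> lam X \<le> k"

definition robust_tangle :: "'a set \<Rightarrow> ('a set \<Rightarrow> int) \<Rightarrow> int \<Rightarrow> 'a set set \<Rightarrow> bool" where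
  "robust_tangle E lam k T \<longleftrightarrow>
     (\<forall>A\<in>T. A \<subseteq> E \<and> lam A < k)
   \<and> (\<forall>A. A \<subseteq> E \<longrightarrow> lam A \<le> k - 1 \<longrightarrow> A \<in> T \<or> E - A \<in> T)
   \<and> (\<forall>F. F \<subseteq> T \<longrightarrow> F \<noteq> {} \<longrightarrow> card F \<le> 8 \<longrightarrow> \<Union>F \<noteq> E)
   \<and> (\<forall>e\<in>E. E - {e} \<notin> T)"

definition weak :: "'a set set \<Rightarrow> 'a set \<Rightarrow> bool" where
  "weak T Y \<longleftrightarrow> (\<exists>A\<in>T. Y \<subseteq> A)"

definition strong :: "'a set \<Rightarrow> 'a set set \<Rightarrow> 'a set \<Rightarrow> bool" where
  "strong E T Y \<longleftrightarrow> Y \<subseteq> E \<and> \<not> weak T Y"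

text \<open>The k-separation (X, E - X) is represented by the set X.\<close>

definition strong_ksep :: "'a set \<Rightarrow> ('a set \<Rightarrow> int) \<Rightarrow> int \<Rightarrow> 'a set set \<Rightarrow> 'a set \<Rightarrow> bool" where
  "strong_ksep E lam k T X \<longleftrightarrow> k_separating E lam k X \<and> strong E T X \<and> strong E T (E - X)"

definition fully_closed :: "'a set \<Rightarrow> ('a set \<Rightarrow> int) \<Rightarrow> int \<Rightarrow> 'a set set \<Rightarrow> 'a set \<Rightarrow> bool" where
  "fully_closed E lam k T X \<longleftrightarrow> strong E T X \<and> k_separating E lam k X
     \<and> (\<forall>Y. Y \<subseteq> E - X \<longrightarrow> Y \<noteq> {} \<longrightarrow> weak T Y \<longrightarrow> \<not> k_separating E lam k (X \<union> Y))"

definition fcl :: "'a set \<Rightarrow> ('a set \<Rightarrow> int) \<Rightarrow> int \<Rightarrow> 'a set set \<Rightarrow> 'a set \<Rightarrow> 'a set" where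
  "fcl E lam k T X = E \<inter> \<Inter>{Z. fully_closed E lam k T Z \<and> X \<subseteq> Z}"

definition T_equiv :: "'a set \<Rightarrow> ('a set \<Rightarrow> int) \<Rightarrow> int \<Rightarrow> 'a set set \<Rightarrow> 'a set \<Rightarrow> 'a set \<Rightarrow> bool" where
  "T_equiv E lam k T X X' \<longleftrightarrow> strong_ksep E lam k T X \<and> strong_ksep E lam k T X'
     \<and> {fcl E lam k T X, fcl E lam k T (E - X)} = {fcl E lam k T X', fcl E lam k T (E - X')}"

definition T_sequential :: "'a set \<Rightarrow> ('a set \<Rightarrow> int) \<Rightarrow> int \<Rightarrow> 'a set set \<Rightarrow> 'a set \<Rightarrow> bool" where
  "T_sequential E lam k T X \<longleftrightarrow> k_separating E lam k X \<and> strong E T (E - X)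
     \<and> fcl E lam k T (E - X) = E"

definition admissible_S :: "'a set \<Rightarrow> ('a set \<Rightarrow> int) \<Rightarrow> int \<Rightarrow> 'a set set \<Rightarrow> 'a set set \<Rightarrow> bool" where
  "admissible_S E lam k T S \<longleftrightarrow> (\<forall>X\<in>S. k_separating E lam k X \<and> strong E T (E - X)
      \<and> \<not> T_sequential E lam k T X)"

definition kS_sep :: "'a set \<Rightarrow> ('a set \<Rightarrow> int) \<Rightarrow> int \<Rightarrow> 'a set set \<Rightarrow> 'a set \<Rightarrow> bool" where
  "kS_sep E lam k S X \<longleftrightarrow> k_separating E lam k X \<and> X \<in> S \<and> E - X \<in> S"

definition tree_compatible :: "'a set \<Rightarrow> ('a set \<Rightarrow> int) \<Rightarrow> int \<Rightarrow> 'a set set \<Rightarrow> 'a set set \<Rightarrow> bool" where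
  "tree_compatible E lam k T S \<longleftrightarrow> admissible_S E lam k T S
    \<and> (\<forall>X X'. kS_sep E lam k S X \<longrightarrow> strong_ksep E lam k T X' \<longrightarrow> T_equiv E lam k T X' X
          \<longrightarrow> kS_sep E lam k S X')
    \<and> (\<forall>X Y. X \<in> S \<longrightarrow> strong_ksep E lam k T Y \<longrightarrow> X \<subseteq> Y \<longrightarrow> Y \<in> S)"

definition k_flower :: "'a set \<Rightarrow> ('a set \<Rightarrow> int) \<Rightarrow> int \<Rightarrow> 'a set set \<Rightarrow> 'a set list \<Rightarrow> bool" where
  "k_flower E lam k T P \<longleftrightarrow>
     \<Union>(set P) = E
   \<and> (\<forall>i<length P. \<forall>j<length P. i \<noteq> j \<longrightarrow> P!i \<inter> P!j = {})
   \<and> (\<forall>i<length P. strong E T (P!i))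
   \<and> (\<forall>i<length P. k_separating E lam k (P!i)
        \<and> k_separating E lam k (P!i \<union> P!((i+1) mod length P)))"

definition displays :: "'a set list \<Rightarrow> 'a set \<Rightarrow> bool" where
  "displays P X \<longleftrightarrow> (\<exists>I\<subseteq>{..<length P}. X = (\<Union>i\<in>I. P!i))"

definition flower_le :: "'a set \<Rightarrow> ('a set \<Rightarrow> int) \<Rightarrow> int \<Rightarrow> 'a set set \<Rightarrow> 'a set set
    \<Rightarrow> 'a set list \<Rightarrow> 'a set list \<Rightarrow> bool" where
  "flower_le E lam k T S P1 P2 \<longleftrightarrow>
     (\<forall>X. kS_sep E lam k S X \<longrightarrow> displays P1 X \<longrightarrow>
        (\<exists>X'. kS_sep E lam k S X' \<and> displays P2 X' \<and> T_equiv E lam k T X X'))"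

definition flower_equiv :: "'a set \<Rightarrow> ('a set \<Rightarrow> int) \<Rightarrow> int \<Rightarrow> 'a set set \<Rightarrow> 'a set set
    \<Rightarrow> 'a set list \<Rightarrow> 'a set list \<Rightarrow> bool" where
  "flower_equiv E lam k T S P1 P2 \<longleftrightarrow> flower_le E lam k T S P1 P2 \<and> flower_le E lam k T S P2 P1"

definition S_tight :: "'a set \<Rightarrow> ('a set \<Rightarrow> int) \<Rightarrow> int \<Rightarrow> 'a set set \<Rightarrow> 'a set set
    \<Rightarrow> 'a set list \<Rightarrow> bool" where
  "S_tight E lam k T S P \<longleftrightarrow>
     \<not> (\<exists>P'. k_flower E lam k T P' \<and> length P' < length P \<and> flower_equiv E lam k T S P P')"

definition S_maximal :: "'a set \<Rightarrow> ('a set \<Rightarrow> int) \<Rightarrow> int \<Rightarrow> 'a set set \<Rightarrow> 'a set set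
    \<Rightarrow> 'a set list \<Rightarrow> bool" where
  "S_maximal E lam k T S P \<longleftrightarrow>
     (\<forall>P'. k_flower E lam k T P' \<longrightarrow> flower_le E lam k T S P P' \<longrightarrow> flower_le E lam k T S P' P)"

definition conforms :: "'a set \<Rightarrow> ('a set \<Rightarrow> int) \<Rightarrow> int \<Rightarrow> 'a set set
    \<Rightarrow> 'a set list \<Rightarrow> 'a set \<Rightarrow> bool" where
  "conforms E lam k T P R \<longleftrightarrow> strong_ksep E lam k T R \<and>
     ((\<exists>X. k_separating E lam k X \<and> displays P X \<and> T_equiv E lam k T R X)
    \<or> (\<exists>R'. k_separating E lam k R' \<and> T_equiv E lam k T R R'
         \<and> (\<exists>i<length P. R' \<subseteq> P!i \<or> E - R' \<subseteq> P!i)))"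

end

theory Submission
  imports Defs
begin

text \<open>Colour the elements of \<^term>\<open>R\<close> red and the others green, and replace \<^term>\<open>R\<close> by an
  equivalent separation with as few bichromatic petals as possible. Then every bichromatic displayed
  set has its two colour classes both weak or both strong, since a lone weak class could be recoloured.
  A petal with two weak classes contradicts tightness: either it can be absorbed by a neighbour,
  or exactly one petal has strong classes and two petals suffice, or eight weak sets cover \<^term>\<open>E\<close>.
  Otherwise every bichromatic petal can be split into its two classes, in one of the two orders,
  which gives a flower that displays \<^term>\<open>R\<close> and refines the given one; maximality finishes
  the proof.\<close>

subsection \<open>Uncrossing and full closure\<close>

text \<open>Apart from complements, new k-separating sets come only from uncrossing: submodularity
  bounds one corner of two crossing sets once the opposite corner and its complement are both
  strong, because (T2) then forces \<open>lam\<close> to be at least \<open>k\<close> there. Weak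
  corners are the obstacle, and the case distinctions on colour classes decide which corners are
  strong. Weak sets also have a use: one may be moved across a separation without changing the
  equivalence class, provided that the result is k-separating and the side receiving it has a full
  closure other than \<open>E\<close>. This is where membership in \<open>S\<close> enters.
  Recolouring is one such move; absorbing a petal into a neighbour takes two, one per weak class.
  The number eight is four blocks times two colours: a petal, an arc next to it, the petal at which
  the growing arc first stops being weak in both colours, and all remaining petals.\<close>

locale tangle_system =
  fixes E :: "'a set" and lam :: "'a set \<Rightarrow> int" and k :: int and T :: "'a set set"
  assumes cs: "connectivity_system E lam" and rt: "robust_tangle E lam k T"
begin

abbreviation "sep \<equiv> k_separating E lam k"
abbreviation "wk \<equiv> weak T"
abbreviation "st \<equiv> strong E T"
abbreviation "sksep \<equiv> strong_ksep E lam k T"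
abbreviation "cl \<equiv> fcl E lam k T"
abbreviation "equi \<equiv> T_equiv E lam k T"
abbreviation "flower \<equiv> k_flower E lam k T"

lemma sep_subset: "sep X \<Longrightarrow> X \<subseteq> E"
  by (simp add: k_separating_def)

lemma strong_subset: "st X \<Longrightarrow> X \<subseteq> E"
  by (simp add: strong_def)

lemma strong_mono: "st X \<Longrightarrow> X \<subseteq> Y \<Longrightarrow> Y \<subseteq> E \<Longrightarrow> st Y"
  unfolding strong_def weak_def by blast

lemma weak_mono: "wk Y \<Longrightarrow> X \<subseteq> Y \<Longrightarrow> wk X"
  unfolding weak_def by blast

lemma strong_iff: "X \<subseteq> E \<Longrightarrow> st X \<longleftrightarrow> \<not> wk X"
  by (simp add: strong_def)

lemma lam_compl: "X \<subseteq> E \<Longrightarrow> lam (E - X) = lam X"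
  using cs[unfolded connectivity_system_def, THEN conjunct2, THEN conjunct1] by metis

lemma sep_compl: "sep X \<Longrightarrow> sep (E - X)"
  unfolding k_separating_def by (simp add: lam_compl)

lemma submodular: "X \<subseteq> E \<Longrightarrow> Y \<subseteq> E \<Longrightarrow> lam (X \<union> Y) + lam (X \<inter> Y) \<le> lam X + lam Y"
  using cs[unfolded connectivity_system_def, THEN conjunct2, THEN conjunct2] by blast

text \<open>This lower bound drives all uncrossing: by (T2), a smaller value of \<open>lam\<close>
  would put one side into \<open>T\<close> and so make it weak.\<close>

lemma strong_pair_order:
  assumes "st X" "st (E - X)" shows "k \<le> lam X"
proof (rule ccontr)
  assume "\<not> k \<le> lam X"
  then have "X \<in> T \<or> E - X \<in> T"
    using rt strong_subset[OF assms(1)] unfolding robust_tangle_def by simp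
  then show False using assms unfolding strong_def weak_def by blast
qed

lemma sep_Un:
  assumes "sep X" "sep Y" "st (X \<inter> Y)" "st (E - (X \<inter> Y))"
  shows "sep (X \<union> Y)"
  using submodular[of X Y] strong_pair_order[OF assms(3,4)] assms(1,2)
  unfolding k_separating_def by auto

lemma sep_Int:
  assumes "sep X" "sep Y" "st (X \<union> Y)" "st (E - (X \<union> Y))"
  shows "sep (X \<inter> Y)"
  using submodular[of X Y] strong_pair_order[OF assms(3,4)] assms(1,2)
  unfolding k_separating_def by auto

text \<open>Submodularity for \<open>X\<close> and its complement gives
  \<open>2 * lam E \<le> 2 * lam X\<close>, since \<open>lam {} = lam E\<close> by symmetry.\<close>

lemma sep_whole:
  assumes "sep X" shows "sep E"
proof -
  have X: "X \<subseteq> E" using sep_subset[OF assms] .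
  have "lam {} = lam E" "lam (E - X) = lam X"
    using lam_compl[of "{}"] lam_compl[OF X] by auto
  moreover have "X \<union> (E - X) = E" "X \<inter> (E - X) = {}" using X by auto
  ultimately show ?thesis using submodular[of X "E - X"] X assms
    unfolding k_separating_def by auto
qed

text \<open>Enlarging each weak set to a member of \<open>T\<close> turns (RT3) into a statement
  about weak sets. Lists allow repetitions, as the image has at most as many members as the
  list.\<close>

lemma weak_no_cover:
  assumes "\<forall>x\<in>set xs. wk x" "xs \<noteq> []" "length xs \<le> 8" shows "\<not> E \<subseteq> \<Union>(set xs)"
proof
  assume c: "E \<subseteq> \<Union>(set xs)"
  obtain f where f: "\<And>x. x \<in> set xs \<Longrightarrow> f x \<in> T \<and> x \<subseteq> f x"
    using assms(1) unfolding weak_def by metis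
  have "card (f ` set xs) \<le> 8"
    by (meson assms(3) card_image_le card_length List.finite_set le_trans)
  moreover have "f ` set xs \<subseteq> T" "f ` set xs \<noteq> {}" using f assms(2) by auto
  ultimately have "\<Union>(f ` set xs) \<noteq> E" using rt unfolding robust_tangle_def by blast
  moreover have "\<Union>(f ` set xs) \<subseteq> E"
    using \<open>f ` set xs \<subseteq> T\<close> rt[unfolded robust_tangle_def, THEN conjunct1] by blast
  moreover have "E \<subseteq> \<Union>(f ` set xs)" using c f by blast
  ultimately show False by blast
qed

lemma strong_compl_weak: "wk A \<Longrightarrow> st (E - A)"
  using weak_no_cover[of "[A, E - A]"] unfolding strong_def by auto

lemma sksepD:
  assumes "sksep X" shows "sep X" "st X" "st (E - X)" "X \<subseteq> E"
  using assms unfolding strong_ksep_def strong_def by auto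

lemma sksep_compl: "sksep X \<Longrightarrow> sksep (E - X)"
  using sep_compl[of X] unfolding strong_ksep_def by (auto simp: double_diff k_separating_def)

text \<open>Only one corner has to be tested for strength, since the complement of
  \<open>R \<inter> U\<close> contains the strong set \<open>E - R\<close>.\<close>

lemma sep_Un_crossing:
  assumes "sksep R" "sep U" "st (R \<inter> U)" shows "sep (R \<union> U)"
proof (rule sep_Un)
  show "st (E - R \<inter> U)" by (rule strong_mono[OF sksepD(3)[OF assms(1)]]) auto
qed (use assms sksepD(1)[OF assms(1)] in auto)

lemma sep_Int_crossing:
  assumes "sksep R" "sep U" "st (E - R - U)" shows "sep (R \<inter> U)"
proof -
  have "E - R - U = E - (R \<union> U)" by blast
  moreover have "st (R \<union> U)"
    by (rule strong_mono[OF sksepD(2)[OF assms(1)]])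
      (use sksepD(4)[OF assms(1)] sep_subset[OF assms(2)] in auto)
  ultimately show ?thesis using assms sksepD(1)[OF assms(1)] sep_Int by simp
qed

lemma sep_Int_compl_crossing:
  assumes "sksep R" "sep U" "st (R - U)" shows "sep (U - R)"
proof -
  have "sep ((E - R) \<inter> U)"
    using sep_Int_crossing[OF sksep_compl[OF assms(1)] assms(2)] assms(3) sksepD[OF assms(1)]
    by (simp add: double_diff)
  moreover have "(E - R) \<inter> U = U - R" using sep_subset[OF assms(2)] by blast
  ultimately show ?thesis by simp
qed

text \<open>Cutting \<open>p \<union> y\<close> down to \<open>R\<close> and then adding
  \<open>y\<close> back needs two uncrossings; the second one goes through the strong set
  \<open>R \<inter> y\<close>. The result is the adjacency condition needed when \<open>p\<close> is
  split by colour.\<close>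

lemma sep_Int_Un_adjacent:
  assumes "sksep R" "sep y" "sep (p \<union> y)" "st (R \<inter> y)" "st (E - R - (p \<union> y))"
  shows "sep ((R \<inter> p) \<union> y)"
proof -
  have "sep (R \<inter> (p \<union> y))" using sep_Int_crossing assms by blast
  moreover have "R \<inter> (p \<union> y) \<inter> y = R \<inter> y" "R \<inter> (p \<union> y) \<union> y = (R \<inter> p) \<union> y" by auto
  moreover have "st (E - R \<inter> y)" using sksepD(3)[OF assms(1)] by (auto elim!: strong_mono)
  ultimately show ?thesis using sep_Un[of "R \<inter> (p \<union> y)" y] assms by simp
qed

lemma fcl_subset: "cl X \<subseteq> E"
  unfolding fcl_def by blast

text \<open>All that is needed of the full closure: it does not change when a weak set is added.\<close>

lemma fcl_weak_extension:
  assumes "sep X" "st X" "wk W" "sep (X \<union> W)"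
  shows "cl (X \<union> W) = cl X"
proof -
  have "W \<subseteq> Z" if Z: "fully_closed E lam k T Z" "X \<subseteq> Z" for Z
  \<comment> \<open>A fully closed \<open>Z\<close> with weak complement is \<open>E\<close>, since
    adding that complement would give the k-separating set \<open>E\<close>. Otherwise
    \<open>Z\<close> can be uncrossed with \<open>X \<union> W\<close>, whose intersection with
    \<open>Z\<close> contains the strong set \<open>X\<close>.\<close>
  proof (cases "wk (E - Z)")
    case True
    then have "E - Z = {}"
      using Z sep_whole[OF assms(1)] unfolding fully_closed_def strong_def
      by (metis Diff_partition order_refl)
    then show ?thesis using sep_subset[OF assms(4)] by blast
  next
    case False
    have z: "Z \<subseteq> E" "sep Z" using Z(1) unfolding fully_closed_def strong_def by auto
    have "st (Z \<inter> (X \<union> W))" by (rule strong_mono[OF assms(2)]) (use Z(2) z in auto)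
    moreover have "st (E - Z \<inter> (X \<union> W))"
      by (rule strong_mono[of "E - Z"]) (use False in \<open>auto simp: strong_iff\<close>)
    ultimately have "sep (Z \<union> (X \<union> W))" using sep_Un z assms(4) by blast
    moreover have "Z \<union> (X \<union> W) = Z \<union> (W - Z)" using Z(2) by blast
    moreover have "W - Z \<subseteq> E - Z" "wk (W - Z)"
      using sep_subset[OF assms(4)] weak_mono[OF assms(3)] by auto
    ultimately have "W - Z = {}" using Z(1) unfolding fully_closed_def by metis
    then show ?thesis by blast
  qed
  then have "{Z. fully_closed E lam k T Z \<and> X \<union> W \<subseteq> Z} = {Z. fully_closed E lam k T Z \<and> X \<subseteq> Z}"
    by blast
  then show ?thesis unfolding fcl_def by simp
qed

lemma fcl_whole: "cl E = E"
  unfolding fcl_def by blast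

text \<open>From \<open>E - U\<close>, adding the weak set \<open>A\<close> gives
  \<open>E - C\<close>, and adding the weak set \<open>C\<close> gives \<open>E\<close>. In other
  words \<open>U\<close> is sequential.\<close>

lemma fcl_compl_of_weak_pair:
  assumes "sep U" "st (E - U)" "U = A \<union> C" "wk A" "wk C" "sep C" "A \<inter> C = {}"
  shows "cl (E - U) = E"
proof -
  have UE: "U \<subseteq> E" using sep_subset[OF assms(1)] .
  have a: "(E - U) \<union> A = E - C" using assms(3,7) UE by blast
  have b: "(E - C) \<union> C = E" using assms(3) UE by blast
  have "cl (E - C) = cl (E - U)"
    using fcl_weak_extension[of "E - U" A] assms sep_compl a by auto
  moreover have "cl E = cl (E - C)"
    using fcl_weak_extension[of "E - C" C] b assms sep_compl sep_whole strong_compl_weak by auto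
  ultimately show ?thesis using fcl_whole by simp
qed

section \<open>Equivalence of strong k-separations\<close>

lemma T_equiv_sym: "equi X Y \<Longrightarrow> equi Y X"
  unfolding T_equiv_def by metis

lemma T_equiv_trans: "equi X Y \<Longrightarrow> equi Y Z \<Longrightarrow> equi X Z"
  unfolding T_equiv_def by metis

lemma T_equiv_refl: "sksep X \<Longrightarrow> equi X X"
  unfolding T_equiv_def by auto

lemma T_equiv_compl: "sksep X \<Longrightarrow> equi X (E - X)"
  using sksep_compl[of X] sksepD(4)[of X] unfolding T_equiv_def
  by (simp add: double_diff insert_commute)

text \<open>The closure condition keeps the new complement strong: a weak complement could be added
  as well, making \<open>cl G\<close> equal to \<open>E\<close>. On the other side,
  \<open>E - G\<close> arises from the new complement by adding the weak set
  \<open>W - G\<close>.\<close>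

lemma T_equiv_weak_extension:
  assumes "sksep G" "cl G \<noteq> E" "wk W" "sep (G \<union> W)"
  shows "equi G (G \<union> W)"
proof -
  note g = sksepD[OF assms(1)]
  have GW: "G \<union> W \<subseteq> E" using sep_subset[OF assms(4)] .
  have c1: "cl (G \<union> W) = cl G" using fcl_weak_extension g assms by blast
  have s1: "st (G \<union> W)" using strong_mono[OF g(2)] GW by blast
  have s2: "st (E - (G \<union> W))"
  proof (rule ccontr)
    assume "\<not> st (E - (G \<union> W))"
    then have "wk (E - (G \<union> W))" by (simp add: strong_iff)
    moreover have "(G \<union> W) \<union> (E - (G \<union> W)) = E" using GW by blast
    ultimately have "cl E = cl (G \<union> W)"
      using fcl_weak_extension[of "G \<union> W" "E - (G \<union> W)"] s1 assms(4) sep_whole by simp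
    then show False using c1 assms(2) fcl_whole by simp
  qed
  have e: "(E - (G \<union> W)) \<union> (W - G) = E - G" using GW by blast
  have "cl (E - G) = cl (E - (G \<union> W))"
    using fcl_weak_extension[of "E - (G \<union> W)" "W - G"] s2 sep_compl[OF assms(4)]
      weak_mono[OF assms(3), of "W - G"] sep_compl[OF g(1)] e by simp
  then show ?thesis unfolding T_equiv_def using c1 assms(1) s1 s2 assms(4)
    by (simp add: strong_ksep_def)
qed

subsection \<open>Flowers\<close>

text \<open>Indices modulo the length become list predicates: the cyclic adjacency is
  \<open>successively\<close> on the list with its head repeated at the end.\<close>

lemma flower_iff:
  assumes "P \<noteq> []"
  shows "flower P \<longleftrightarrow> \<Union>(set P) = E \<and> sorted_wrt (\<lambda>x y. x \<inter> y = {}) P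
    \<and> (\<forall>x\<in>set P. st x \<and> sep x) \<and> successively (\<lambda>x y. sep (x \<union> y)) (P @ [hd P])"
proof -
  have d: "(\<forall>i<length P. \<forall>j<length P. i \<noteq> j \<longrightarrow> P!i \<inter> P!j = {}) \<longleftrightarrow>
      sorted_wrt (\<lambda>x y. x \<inter> y = {}) P"
    (is "?L \<longleftrightarrow> ?R")
  proof
    assume r: ?R
    show ?L
    proof (intro allI impI)
      fix i j assume "i < length P" "j < length P" "i \<noteq> j"
      then show "P!i \<inter> P!j = {}"
        using r sorted_wrt_nth_less[of _ P i j] sorted_wrt_nth_less[of _ P j i]
        by (cases "i < j") (force simp: Int_commute)+
    qed
  qed (simp add: sorted_wrt_iff_nth_less)
  have n: "(P @ [hd P]) ! Suc i = P ! ((i+1) mod length P)" if "i < length P" for i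
  proof (cases "Suc i = length P")
    case True
    then show ?thesis using assms by (simp add: hd_conv_nth)
  next
    case False
    then show ?thesis using that by (simp add: nth_append)
  qed
  have s: "successively (\<lambda>x y. sep (x \<union> y)) (P @ [hd P]) \<longleftrightarrow>
      (\<forall>i<length P. sep (P!i \<union> P!((i+1) mod length P)))"
    unfolding successively_conv_nth using n by (auto simp: nth_append)
  show ?thesis unfolding k_flower_def d s all_set_conv_all_nth by blast
qed

text \<open>The cycle is opened at \<open>p\<close>, so replacing \<open>p\<close> by other sets
  affects only the conditions at the two ends of \<open>zs\<close>.\<close>

lemma flower_Cons_iff:
  "flower (p # zs) \<longleftrightarrow> p \<union> \<Union>(set zs) = E \<and> (\<forall>z\<in>set zs. p \<inter> z = {})
    \<and> sorted_wrt (\<lambda>x y. x \<inter> y = {}) zs \<and> st p \<and> sep p \<and> (\<forall>x\<in>set zs. st x \<and> sep x)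
    \<and> (zs \<noteq> [] \<longrightarrow> successively (\<lambda>x y. sep (x \<union> y)) zs \<and> sep (p \<union> hd zs) \<and> sep (p \<union> last zs))"
  using flower_iff[of "p # zs"]
  by (cases zs) (auto simp: successively_append_iff successively_Cons Un_commute)

lemma flower_rotate:
  assumes "flower (xs @ ys)" shows "flower (ys @ xs)"
proof (cases "xs = [] \<or> ys = []")
  case False
  then show ?thesis using assms
    by (subst flower_iff, simp, subst (asm) flower_iff)
      (auto simp: sorted_wrt_append successively_append_iff Int_commute)
qed (use assms in auto)

lemma flower_rev:
  assumes "flower P" shows "flower (rev P)"
proof (cases "P = []")
  case False
  then obtain p zs where P: "P = p # zs" by (cases P) auto
  have "successively (\<lambda>x y. sep (x \<union> y)) (rev zs) \<longleftrightarrow> successively (\<lambda>x y. sep (x \<union> y)) zs"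
    by (simp add: successively_rev Un_commute)
  moreover have "sorted_wrt (\<lambda>x y. x \<inter> y = {}) (rev zs) \<longleftrightarrow> sorted_wrt (\<lambda>x y. x \<inter> y = {}) zs"
    by (simp add: sorted_wrt_rev Int_commute)
  ultimately have "flower (p # rev zs)"
    using assms unfolding P flower_Cons_iff by (simp add: hd_rev last_rev)
  then have "flower ([p] @ rev zs)" by simp
  then show ?thesis using flower_rotate P by fastforce
qed (use assms in auto)

lemma flower_petal:
  assumes "flower P" "p \<in> set P" shows "st p" "sep p" "p \<subseteq> E"
  using assms unfolding k_flower_def in_set_conv_nth strong_def by auto

lemma flower_Union: "flower P \<Longrightarrow> \<Union>(set P) = E"
  unfolding k_flower_def by simp

lemma flower_disjoint: "flower P \<Longrightarrow> p \<in> set P \<Longrightarrow> q \<in> set P \<Longrightarrow> p \<noteq> q \<Longrightarrow> p \<inter> q = {}"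
  unfolding k_flower_def in_set_conv_nth by (elim conjE exE) metis

lemma displays_iff_Union: "displays P X \<longleftrightarrow> (\<exists>Q\<subseteq>set P. X = \<Union>Q)"
proof
  assume "displays P X"
  then obtain I where "I \<subseteq> {..<length P}" "X = \<Union>((!) P ` I)" unfolding displays_def by blast
  then show "\<exists>Q\<subseteq>set P. X = \<Union>Q" by (intro exI[of _ "(!) P ` I"]) auto
next
  assume "\<exists>Q\<subseteq>set P. X = \<Union>Q"
  then obtain Q where Q: "Q \<subseteq> set P" "X = \<Union>Q" by blast
  have "Q = (!) P ` {i\<in>{..<length P}. P!i \<in> Q}"
    using Q(1) by (auto simp: in_set_conv_nth subset_iff image_iff)
  then show "displays P X" unfolding displays_def using Q(2)
    by (intro exI[of _ "{i\<in>{..<length P}. P!i \<in> Q}"]) auto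
qed

lemma displays_iff:
  assumes "flower P"
  shows "displays P X \<longleftrightarrow> X \<subseteq> E \<and> (\<forall>p\<in>set P. p \<subseteq> X \<or> p \<inter> X = {})"
proof
  assume "displays P X"
  then obtain Q where Q: "Q \<subseteq> set P" "X = \<Union>Q" unfolding displays_iff_Union by blast
  have "p \<subseteq> X \<or> p \<inter> X = {}" if "p \<in> set P" for p
  proof (cases "p \<in> Q")
    case False
    then have "p \<inter> q = {}" if "q \<in> Q" for q
      using flower_disjoint[OF assms \<open>p \<in> set P\<close>, of q] Q(1) that by blast
    then show ?thesis using Q(2) by blast
  qed (use Q in blast)
  moreover have "X \<subseteq> E" using Q flower_Union[OF assms] by blast
  ultimately show "X \<subseteq> E \<and> (\<forall>p\<in>set P. p \<subseteq> X \<or> p \<inter> X = {})" by blast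
next
  assume X: "X \<subseteq> E \<and> (\<forall>p\<in>set P. p \<subseteq> X \<or> p \<inter> X = {})"
  have "x \<in> \<Union>{p\<in>set P. p \<subseteq> X}" if "x \<in> X" for x
  proof -
    have "x \<in> \<Union>(set P)" using that X flower_Union[OF assms] by auto
    then obtain p where p: "p \<in> set P" "x \<in> p" by blast
    then have "p \<subseteq> X" using that X[THEN conjunct2, THEN bspec, OF p(1)] by blast
    then show ?thesis using p by blast
  qed
  then have eq: "X = \<Union>{p\<in>set P. p \<subseteq> X}" by blast
  show "displays P X" unfolding displays_iff_Union
    by (rule exI[of _ "{p\<in>set P. p \<subseteq> X}"], rule conjI, blast, rule eq)
qed

lemma displays_cong: "set P = set Q \<Longrightarrow> displays P = displays Q"
  by (auto simp: fun_eq_iff displays_iff_Union)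

lemma displays_Union_petals: "set Q \<subseteq> set P \<Longrightarrow> displays P (\<Union>(set Q))"
  unfolding displays_iff_Union by blast

lemma flower_append_disjoint:
  assumes "flower (xs @ ys)" shows "\<Union>(set xs) \<inter> \<Union>(set ys) = {}"
proof (cases "xs @ ys = []")
  case False
  then show ?thesis using assms by (subst (asm) flower_iff) (auto simp: sorted_wrt_append)
qed auto

text \<open>The arc grows by one petal \<open>x\<close> at a time: the old arc and
  \<open>w \<union> x\<close>, with \<open>w\<close> its last petal, meet exactly in
  \<open>w\<close>, which is strong and has a complement containing the strong petal
  \<open>x\<close>.\<close>

lemma flower_arc_sep:
  assumes "flower (xs @ ys)" "xs \<noteq> []"
  shows "sep (\<Union>(set xs))"
  using assms
proof (induction xs arbitrary: ys rule: rev_induct)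
  case (snoc x xs)
  show ?case
  proof (cases "xs = []")
    case True
    then show ?thesis using flower_petal(2)[OF snoc.prems(1), of x] by simp
  next
    case False
    then obtain ws w where w: "xs = ws @ [w]" by (metis rev_exhaust)
    have f: "flower (ws @ [w] @ x # ys)" using snoc.prems w by simp
    have s: "sep (\<Union>(set xs))" using snoc.IH[of "x # ys"] snoc.prems False by simp
    have "sep (w \<union> x)" using f
      by (subst (asm) flower_iff) (auto simp: successively_append_iff)
    moreover have "ws @ [w] @ x # ys = (ws @ [w]) @ (x # ys)" by simp
    then have dx: "\<Union>(set xs) \<inter> x = {}"
      using flower_append_disjoint[of "ws @ [w]" "x # ys"] f w by auto
    then have "\<Union>(set xs) \<inter> (w \<union> x) = w" using w by auto
    moreover have "st w" "st x" using flower_petal(1)[OF f] by auto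
    moreover have "st (E - w)"
      by (rule strong_mono[OF \<open>st x\<close>]) (use strong_subset[OF \<open>st x\<close>] dx w in auto)
    ultimately have "sep (\<Union>(set xs) \<union> (w \<union> x))" using sep_Un[OF s] by simp
    then show ?thesis using w by (simp add: Un_ac)
  qed
qed simp

section \<open>Merging and splitting petals\<close>

lemma flower_merge:
  assumes "flower (x # y # zs)" shows "flower ((x \<union> y) # zs)"
proof -
  have s: "sep (x \<union> y)" using flower_arc_sep[of "[x,y]" zs] assms by simp
  have t: "st (x \<union> y)"
    using flower_petal[OF assms, of x] flower_petal(3)[OF assms, of y] strong_mono[of x] by auto
  \<comment> \<open>The adjacency conditions at the merged petal are arcs of three old
    petals.\<close>
  have u: "sep (x \<union> y \<union> hd zs)" if "zs \<noteq> []"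
    using that flower_arc_sep[of "[x,y,hd zs]" "tl zs"] assms by (simp add: Un_assoc)
  have "sep (last zs \<union> (x \<union> y))" if "zs \<noteq> []"
  proof -
    have "flower (zs @ [x,y])" using flower_rotate[of "[x,y]" zs] assms by simp
    then have "flower (butlast zs @ [last zs, x, y])" using that
      by (metis append.assoc append_Cons append_Nil append_butlast_last_id)
    then show ?thesis
      using flower_arc_sep[of "[last zs, x, y]" "butlast zs"] flower_rotate by fastforce
  qed
  then show ?thesis using assms s t u
    unfolding flower_Cons_iff by (cases zs) (auto simp: successively_Cons Un_ac Int_Un_distrib2)
qed

lemma flower_split:
  assumes "flower (p # zs)" "zs \<noteq> []" "p = X \<union> Y" "X \<inter> Y = {}" "st X" "st Y" "sep X" "sep Y"
    "sep (X \<union> last zs)" "sep (Y \<union> hd zs)"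
  shows "flower (X # Y # zs)"
  using assms flower_petal(2)[OF assms(1), of p]
  unfolding flower_Cons_iff by (cases zs) (auto simp: Int_Un_distrib2)

text \<open>The complement of \<open>A \<union> y\<close> meets \<open>p \<union> z\<close> in
  \<open>B \<union> z\<close>, and their union misses only the strong petal \<open>y\<close>. Thus
  one of the two outer adjacency conditions of a split implies the other.\<close>

lemma flower_split_transfer:
  assumes f: "flower (p # y # ms @ [z])" and p: "p = A \<union> B" "A \<inter> B = {}" and s: "sep (A \<union> y)"
  shows "sep (B \<union> z)"
proof -
  have "flower ([p] @ (y # ms @ [z]))" "flower ([p, y] @ (ms @ [z]))" using f by simp_all
  note d = this[THEN flower_append_disjoint]
  have fr: "flower ([z, p] @ (y # ms))" "flower ((ms @ [z, p]) @ [y])"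
    using f flower_rotate[of "p # y # ms" "[z]"] flower_rotate[of "[p, y]" "ms @ [z]"]
      flower_rotate[of "y # ms @ [z]" "[p]"] flower_rotate[of "[p]" "y # ms @ [z]"]
      flower_rotate[of "[y]" "ms @ [z, p]"] by simp_all
  let ?M = "\<Union>(set ms)"
  have zp: "sep (p \<union> z)" using flower_arc_sep[OF fr(1)] by (simp add: Un_commute)
  have U: "E = p \<union> y \<union> ?M \<union> z" using flower_Union[OF f] by auto
  have d3: "y \<inter> (?M \<union> z) = {}" using flower_append_disjoint[OF fr(2)] d by auto
  have d2: "z \<inter> ?M = {}"
    using flower_append_disjoint[of "p # y # ms" "[z]"] f by auto
  have c: "E - (A \<union> y) = B \<union> ?M \<union> z" using U p d d3 by auto
  have "sep (B \<union> ?M \<union> z)" using sep_compl[OF s] c by simp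
  moreover have "(B \<union> ?M \<union> z) \<inter> (p \<union> z) = B \<union> z" using p d by auto
  moreover have u: "(B \<union> ?M \<union> z) \<union> (p \<union> z) = p \<union> ?M \<union> z" using p by auto
  moreover have "E - (p \<union> ?M \<union> z) = y" using U d d3 by auto
  moreover have "st y" using flower_petal(1)[OF f] by simp
  moreover have "st (p \<union> ?M \<union> z)"
    by (rule strong_mono[of p]) (use flower_petal(1)[OF f] in simp, blast, subst U, blast)
  ultimately show ?thesis using sep_Int[of "B \<union> ?M \<union> z" "p \<union> z"] zp by simp
qed

lemma flower_split_petal:
  assumes f: "flower (p # zs)" and zs: "zs \<noteq> []" and R: "sksep R"
    and pt: "\<And>q. q \<in> set zs \<Longrightarrow>
       (R \<inter> q = {} \<or> st (R \<inter> q)) \<and> (q - R = {} \<or> st (q - R))"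
    and s: "st (R \<inter> p)" "st (p - R)" and ne: "R - p \<noteq> {}" "E - R - p \<noteq> {}"
  shows "flower ((p - R) # (R \<inter> p) # zs) \<or> flower ((R \<inter> p) # (p - R) # zs)"
proof -
  let ?A = "R \<inter> p" and ?B = "p - R"
  have RE: "R \<subseteq> E" using sksepD[OF R] by simp
  \<comment> \<open>As every red class outside \<open>p\<close> is empty or strong, a nonempty red
    set made of such classes contains a strong one.\<close>
  have red: "st Q" if Q: "Q \<subseteq> R" "Q \<subseteq> \<Union>(set qs)" "Q \<noteq> {}"
    and i: "set qs \<subseteq> set zs" "\<And>q. q \<in> set qs \<Longrightarrow> R \<inter> q \<subseteq> Q" for Q qs
  proof -
    obtain q where q: "q \<in> set qs" "R \<inter> q \<noteq> {}" using Q by blast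
    then have "st (R \<inter> q)" using pt[of q] i(1) by auto
    then show ?thesis by (rule strong_mono[OF _ i(2)[OF q(1)]]) (use Q(1) RE in simp)
  qed
  have green: "st Q" if Q: "Q \<subseteq> E - R" "Q \<subseteq> \<Union>(set qs)" "Q \<noteq> {}"
    and i: "set qs \<subseteq> set zs" "\<And>q. q \<in> set qs \<Longrightarrow> q - R \<subseteq> Q" for Q qs
  proof -
    obtain q where q: "q \<in> set qs" "q - R \<noteq> {}" using Q by blast
    then have "st (q - R)" using pt[of q] i(1) by auto
    then show ?thesis by (rule strong_mono[OF _ i(2)[OF q(1)]]) (use Q(1) in blast)
  qed
  have U: "E = p \<union> \<Union>(set zs)" and d: "p \<inter> \<Union>(set zs) = {}"
    using flower_Union[OF f] flower_append_disjoint[of "[p]" zs] f by auto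
  have "st (R - p)" by (rule red[of _ zs]) (use ne U d RE in auto)
  have "st (E - R - p)" by (rule green[of _ zs]) (use ne U d RE in auto)
  have sA: "sep ?A" and sB: "sep ?B"
    using sep_Int_crossing[OF R _ \<open>st (E - R - p)\<close>] sep_Int_compl_crossing[OF R _ \<open>st (R - p)\<close>]
      flower_petal(2)[OF f] by auto
  have pAB: "p = ?B \<union> ?A" "?B \<inter> ?A = {}" "p = ?A \<union> ?B" "?A \<inter> ?B = {}" by auto
  have "(sep (?A \<union> hd zs) \<and> sep (?B \<union> last zs)) \<or> (sep (?B \<union> hd zs) \<and> sep (?A \<union> last zs))"
  proof (cases "tl zs = []")
    case True
    then obtain y where y: "zs = [y]" using zs by (cases zs) auto
    have "E - ?B = ?A \<union> y" "E - ?A = ?B \<union> y" using U d y by auto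
    then show ?thesis using sep_compl[OF sA] sep_compl[OF sB] y by simp
  next
    case False
    then obtain y ms z where y: "zs = y # ms @ [z]" using zs
      by (metis list.collapse append_butlast_last_id)
    have f1: "flower (p # y # ms @ [z])" using f y by simp
    have "flower (rev (y # ms @ [z]) @ [p])" using flower_rev[OF f1] by simp
    then have f2: "flower (p # z # rev ms @ [y])" using flower_rotate by fastforce
    have dd: "y \<inter> (\<Union>(set ms) \<union> z) = {}" "z \<inter> (\<Union>(set ms) \<union> y) = {}"
      using flower_append_disjoint[of "[p,y]" "ms @ [z]"] flower_append_disjoint[of "[p,z]" "rev ms @ [y]"]
        f1 f2 by auto
    have py: "sep (p \<union> y)" "sep (p \<union> z)"
      using flower_arc_sep[of "[p,y]" "ms @ [z]"] flower_arc_sep[of "[p,z]" "rev ms @ [y]"] f1 f2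
      by auto
    have syz: "sep y" "sep z" using flower_petal(2)[OF f1] by auto
    have RR: "sksep (E - R)" and EE: "E - (E - R) = R" using sksep_compl[OF R] RE by auto
    have Bp: "(E - R) \<inter> p = ?B" "(E - R) \<inter> y = y - R" using flower_petal(3)[OF f1] by auto
    \<comment> \<open>One k-separating union of a class with an end petal suffices by
      \<open>flower_split_transfer\<close>. In case (a) red attaches to \<open>y\<close> by a direct
      uncrossing.\<close>
    consider (a) "R \<inter> y \<noteq> {}" "E - R - (p \<union> y) \<noteq> {}" | (b) "R \<inter> y \<noteq> {}" "E - R - (p \<union> y) = {}"
      | (c) "R \<inter> y = {}" by blast
    then show ?thesis
    proof cases
      case a
      have "st (E - R - (p \<union> y))"
        by (rule green[of _ "ms @ [z]"]) (use a U d y dd in auto)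
      then have "sep (?A \<union> y)"
        using sep_Int_Un_adjacent[OF R syz(1) py(1)] pt[of y] y a by auto
      then show ?thesis using flower_split_transfer[OF f1 pAB(3,4)] y by auto
    next
      case b
      \<comment> \<open>Here \<open>z\<close> is wholly red, and the green outside \<open>p\<close>
        lies in \<open>y\<close>, so red attaches to \<open>z\<close> instead.\<close>
      have zR: "z \<subseteq> R" using b(2) U d dd y by auto
      then have "st (R \<inter> z)" using flower_petal(1)[OF f1, of z] by (simp add: Int_absorb1)
      moreover have "st (E - R - (p \<union> z))"
        by (rule green[of _ "y # ms"]) (use ne zR U d y dd in auto)
      ultimately have "sep (?A \<union> z)" using sep_Int_Un_adjacent[OF R syz(2) py(2)] by blast
      then show ?thesis using flower_split_transfer[OF f2 pAB(3,4)] y by auto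
    next
      case c
      \<comment> \<open>Here \<open>y\<close> is wholly green, so the colours are exchanged; the red
        outside \<open>p\<close> lies beyond \<open>y\<close>.\<close>
      have "st (E - (E - R) - (p \<union> y))" unfolding EE
        by (rule red[of _ "ms @ [z]"]) (use ne c U d y dd RE in auto)
      moreover have "st ((E - R) \<inter> y)"
        using c flower_petal(1)[OF f1, of y] Bp by (simp add: Diff_triv Int_commute)
      ultimately have "sep (?B \<union> y)"
        using sep_Int_Un_adjacent[OF RR syz(1) py(1)] Bp by simp
      then show ?thesis using flower_split_transfer[OF f1 pAB(1,2)] y by auto
    qed
  qed
  then show ?thesis
    using flower_split[OF f zs pAB(1,2) s(2,1) sB sA] flower_split[OF f zs pAB(3,4) s sA sB] by blast
qed

text \<open>Induction on the number of bichromatic petals. A split leaves two strong monochromatic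
  petals, so the strength hypothesis survives; the last hypothesis keeps both colours present
  outside the petal being split.\<close>

lemma flower_refine:
  assumes "flower P" "length P \<ge> 2" and R: "sksep R"
    and "\<And>q. q \<in> set P \<Longrightarrow> (R \<inter> q = {} \<or> st (R \<inter> q)) \<and> (q - R = {} \<or> st (q - R))"
    and "\<And>q. q \<in> set P \<Longrightarrow> \<not> R \<subseteq> q \<and> \<not> E - R \<subseteq> q"
  shows "\<exists>P'. flower P' \<and> displays P' R \<and> (\<forall>U. displays P U \<longrightarrow> displays P' U)"
  using assms(1,2,4,5)
proof (induction "length (filter (\<lambda>p. R \<inter> p \<noteq> {} \<and> p - R \<noteq> {}) P)" arbitrary: P rule: less_induct)
  case less
  note f = less.prems(1)
  show ?case
  proof (cases "\<forall>p\<in>set P. R \<inter> p = {} \<or> p - R = {}")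
    case True
    then have "displays P R" using sksepD(4)[OF R] displays_iff[OF f] by auto
    then show ?thesis using f by blast
  next
    case False
    then obtain p where p: "p \<in> set P" "R \<inter> p \<noteq> {}" "p - R \<noteq> {}" by blast
    obtain xs ys where P: "P = xs @ p # ys" using p(1) by (meson split_list)
    define zs where "zs = ys @ xs"
    have f1: "flower (p # zs)" using flower_rotate[of xs "p # ys"] f P zs_def by simp
    have set1: "set P = set (p # zs)" using P zs_def by auto
    have zs: "zs \<noteq> []" using less.prems(2) P zs_def by auto
    have pt: "(R \<inter> q = {} \<or> st (R \<inter> q)) \<and> (q - R = {} \<or> st (q - R))" if "q \<in> set zs" for q
      using less.prems(3)[of q] that set1 by auto
    have sp: "st (R \<inter> p)" "st (p - R)" using less.prems(3)[of p] p by auto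
    have ne: "R - p \<noteq> {}" "E - R - p \<noteq> {}" using less.prems(4)[of p] p by auto
    obtain P' where P': "flower P'" "P' = (p - R) # (R \<inter> p) # zs \<or> P' = (R \<inter> p) # (p - R) # zs"
      using flower_split_petal[OF f1 zs R pt sp ne] by blast
    have len: "length (filter (\<lambda>p. R \<inter> p \<noteq> {} \<and> p - R \<noteq> {}) P') <
        length (filter (\<lambda>p. R \<inter> p \<noteq> {} \<and> p - R \<noteq> {}) P)"
      using P'(2) p P zs_def by auto
    have set2: "set P' = {p - R, R \<inter> p} \<union> set zs" using P'(2) by auto
    have "\<exists>P''. flower P'' \<and> displays P'' R \<and> (\<forall>U. displays P' U \<longrightarrow> displays P'' U)"
    proof (rule less.hyps[OF len P'(1)])
      show "2 \<le> length P'" using P'(2) by auto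
      show "(R \<inter> q = {} \<or> st (R \<inter> q)) \<and> (q - R = {} \<or> st (q - R))" if q: "q \<in> set P'" for q
      proof -
        consider "q = p - R" | "q = R \<inter> p" | "q \<in> set zs" using q unfolding set2 by blast
        then show ?thesis
        proof cases
          case 1
          then have "R \<inter> q = {}" "q - R = q" by auto
          then show ?thesis using 1 sp by simp
        next
          case 2
          then have "R \<inter> q = q" "q - R = {}" by auto
          then show ?thesis using 2 sp by simp
        qed (rule pt)
      qed
      show "\<not> R \<subseteq> q \<and> \<not> E - R \<subseteq> q" if "q \<in> set P'" for q
        using that set2 less.prems(4)[of p] less.prems(4)[of q] p set1 by auto
    qed
    moreover have "displays P' U" if "displays P U" for U
      using that displays_iff[OF f, of U] displays_iff[OF P'(1), of U] set1 set2 by auto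
    ultimately show ?thesis by blast
  qed
qed

end

subsection \<open>Separations in a tree compatible set\<close>

locale tree_compatible_set = tangle_system +
  fixes S :: "'a set set"
  assumes tc: "tree_compatible E lam k T S"
begin

abbreviation "kS \<equiv> kS_sep E lam k S"
abbreviation "tight \<equiv> S_tight E lam k T S"

lemma kS_D:
  assumes "kS X"
  shows "X \<subseteq> E" "sksep X" "cl X \<noteq> E" "cl (E - X) \<noteq> E" "kS (E - X)"
proof -
  have X: "sep X" "X \<in> S" "E - X \<in> S" using assms unfolding kS_sep_def by auto
  show XE: "X \<subseteq> E" using sep_subset[OF X(1)] .
  have adm: "sep Y \<and> st (E - Y) \<and> \<not> T_sequential E lam k T Y" if "Y \<in> S" for Y
    using tc[unfolded tree_compatible_def, THEN conjunct1, unfolded admissible_S_def] that by blast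
  have EX: "E - (E - X) = X" using XE by blast
  show "sksep X" using adm[OF X(2)] adm[OF X(3)] EX unfolding strong_ksep_def by simp
  show "cl X \<noteq> E" "cl (E - X) \<noteq> E"
    using adm[OF X(2)] adm[OF X(3)] EX unfolding T_sequential_def by simp_all
  show "kS (E - X)" using X EX sep_compl unfolding kS_sep_def by simp
qed

lemma kS_equiv:
  assumes "kS X" "equi X Y" shows "kS Y"
  using tc[unfolded tree_compatible_def, THEN conjunct2, THEN conjunct1] assms T_equiv_sym[of X Y]
  unfolding T_equiv_def by metis

lemma kS_weak_extension:
  assumes "kS G" "wk W" "sep (G \<union> W)" shows "equi G (G \<union> W)" "kS (G \<union> W)"
proof -
  show "equi G (G \<union> W)" using T_equiv_weak_extension kS_D[OF assms(1)] assms by blast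
  then show "kS (G \<union> W)" using kS_equiv assms by blast
qed

text \<open>Seen from \<open>E - R\<close>, the strong set \<open>U - R\<close> makes the union with
  \<open>U\<close> k-separating, and the only part added is the weak set
  \<open>R \<inter> U\<close>.\<close>

lemma kS_recolour:
  assumes "kS R" "sep U" "wk (R \<inter> U)" "st (U - R)"
  shows "equi R (R - U)" "kS (R - U)"
proof -
  note r = kS_D[OF assms(1)]
  have UE: "U \<subseteq> E" using sep_subset[OF assms(2)] .
  have "(E - R) \<inter> U = U - R" using UE by blast
  then have "sep ((E - R) \<union> U)" using sep_Un_crossing[OF sksep_compl[OF r(2)] assms(2)] assms(4) by simp
  moreover have "(E - R) \<union> U = (E - R) \<union> (R \<inter> U)" using UE by blast
  ultimately have m: "equi (E - R) ((E - R) \<union> U)" "kS ((E - R) \<union> U)"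
    using kS_weak_extension[OF r(5) assms(3)] by simp_all
  have e: "E - ((E - R) \<union> U) = R - U" using r(1) by blast
  show "kS (R - U)" using kS_D(5)[OF m(2)] e by simp
  show "equi R (R - U)"
    using T_equiv_trans[OF T_equiv_compl[OF r(2)] T_equiv_trans[OF m(1) T_equiv_compl[OF kS_D(2)[OF m(2)]]]] e
    by simp
qed

text \<open>All displayed k-separating sets are included, not just petals, because the condition is
  later applied to arcs and to arbitrary displayed separations.\<close>

definition settled :: "'a set \<Rightarrow> 'a set list \<Rightarrow> bool" where
  "settled R P \<longleftrightarrow> (\<forall>U. sep U \<longrightarrow> displays P U \<longrightarrow>
     R \<inter> U = {} \<or> U - R = {} \<or> (wk (R \<inter> U) \<longleftrightarrow> wk (U - R)))"

lemma exists_settled: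
  assumes P: "flower P" and "kS R"
  shows "\<exists>R'. kS R' \<and> equi R R' \<and> settled R' P"
proof -
  define b where "b R = card {p\<in>set P. R \<inter> p \<noteq> {} \<and> p - R \<noteq> {}}" for R
  have "equi R R" using T_equiv_refl kS_D(2)[OF assms(2)] by blast
  then obtain Q where Q: "kS Q" "equi R Q"
    and least: "\<And>Q'. kS Q' \<Longrightarrow> equi R Q' \<Longrightarrow> b Q \<le> b Q'"
    using ex_has_least_nat[of "\<lambda>Q. kS Q \<and> equi R Q" R b] assms(2) by blast
  \<comment> \<open>Recolouring \<open>U\<close> would make each of its petals green and leave the
    others alone. A petal of \<open>U\<close> containing red was bichromatic, as a wholly red one
    would be weak, so the count would drop. The statement is for \<open>Q'\<close> so that it covers
    both \<open>Q\<close> and \<open>E - Q\<close>.\<close>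
  have key: "\<not> st (U - Q')"
    if Q': "kS Q'" "equi R Q'" "b Q' = b Q"
      and U: "sep U" "displays P U" "wk (Q' \<inter> U)" "Q' \<inter> U \<noteq> {}" for Q' U
  proof
    assume s: "st (U - Q')"
    have "kS (Q' - U)" "equi R (Q' - U)"
      using kS_recolour[OF Q'(1) U(1,3) s] T_equiv_trans[OF Q'(2)] by simp_all
    then have le: "b Q' \<le> b (Q' - U)" using least Q'(3) by simp
    have dis: "U \<subseteq> E" "\<And>p. p \<in> set P \<Longrightarrow> p \<subseteq> U \<or> p \<inter> U = {}"
      using U(2) displays_iff[OF P] by auto
    obtain x where x: "x \<in> Q'" "x \<in> U" using U(4) by blast
    then have "x \<in> \<Union>(set P)" using flower_Union[OF P] dis(1) by auto
    then obtain p where p: "p \<in> set P" "x \<in> p" by blast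
    have pU: "p \<subseteq> U" using dis(2)[OF p(1)] p(2) x(2) by blast
    have "p - Q' \<noteq> {}"
    proof
      assume "p - Q' = {}"
      then have "p \<subseteq> Q' \<inter> U" using pU by blast
      then have "wk p" using weak_mono[OF U(3)] by blast
      then show False using flower_petal(1)[OF P p(1)] by (simp add: strong_def)
    qed
    then have "p \<in> {p\<in>set P. Q' \<inter> p \<noteq> {} \<and> p - Q' \<noteq> {}}" using p x by auto
    moreover have "p \<notin> {p\<in>set P. (Q' - U) \<inter> p \<noteq> {} \<and> p - (Q' - U) \<noteq> {}}" using pU by auto
    moreover have "{p\<in>set P. (Q' - U) \<inter> p \<noteq> {} \<and> p - (Q' - U) \<noteq> {}}
        \<subseteq> {p\<in>set P. Q' \<inter> p \<noteq> {} \<and> p - Q' \<noteq> {}}"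
    proof
      fix q assume q: "q \<in> {p\<in>set P. (Q' - U) \<inter> p \<noteq> {} \<and> p - (Q' - U) \<noteq> {}}"
      then have "q \<inter> U = {}" using dis(2)[of q] by blast
      then show "q \<in> {p\<in>set P. Q' \<inter> p \<noteq> {} \<and> p - Q' \<noteq> {}}" using q by auto
    qed
    ultimately have "{p\<in>set P. (Q' - U) \<inter> p \<noteq> {} \<and> p - (Q' - U) \<noteq> {}}
        \<subset> {p\<in>set P. Q' \<inter> p \<noteq> {} \<and> p - Q' \<noteq> {}}" by blast
    then have "b (Q' - U) < b Q'" unfolding b_def by (intro psubset_card_mono) auto
    then show False using le by simp
  qed
  note q = kS_D[OF Q(1)]
  have c: "kS (E - Q)" "equi R (E - Q)"
    using q T_equiv_trans[OF Q(2) T_equiv_compl[OF q(2)]] by simp_all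
  have "{p\<in>set P. (E - Q) \<inter> p \<noteq> {} \<and> p - (E - Q) \<noteq> {}} = {p\<in>set P. Q \<inter> p \<noteq> {} \<and> p - Q \<noteq> {}}"
    using flower_petal(3)[OF P] by blast
  then have bc: "b (E - Q) = b Q" unfolding b_def by simp
  have "settled Q P" unfolding settled_def
  proof (intro allI impI)
    fix U assume U: "sep U" "displays P U"
    have e: "(E - Q) \<inter> U = U - Q" "U - (E - Q) = Q \<inter> U" using sep_subset[OF U(1)] by auto
    have s: "st (U - Q) \<longleftrightarrow> \<not> wk (U - Q)" "st (Q \<inter> U) \<longleftrightarrow> \<not> wk (Q \<inter> U)"
      using sep_subset[OF U(1)] by (auto intro!: strong_iff)
    show "Q \<inter> U = {} \<or> U - Q = {} \<or> (wk (Q \<inter> U) \<longleftrightarrow> wk (U - Q))"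
      using key[OF Q refl U] key[OF c bc U] e s by auto
  qed
  then show ?thesis using Q by blast
qed

section \<open>Consequences of tightness\<close>

lemma tight_cong:
  assumes "tight P" "set P = set Q" "length P = length Q" shows "tight Q"
  using assms(1) unfolding S_tight_def flower_equiv_def flower_le_def
    displays_cong[OF assms(2)] assms(3) .

lemma tight_contradiction:
  assumes "tight P" "flower P'" "length P' < length P"
    and "\<And>X. kS X \<Longrightarrow> displays P X \<Longrightarrow> \<exists>X'. kS X' \<and> displays P' X' \<and> equi X X'"
    and "\<And>X. displays P' X \<Longrightarrow> displays P X"
  shows False
proof -
  have "flower_le E lam k T S P P'" using assms(4) unfolding flower_le_def by blast
  moreover have "flower_le E lam k T S P' P" unfolding flower_le_def
    using assms(5) T_equiv_refl kS_D(2) by blast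
  ultimately show False using assms(1-3) unfolding S_tight_def flower_equiv_def by blast
qed

lemma displays_compl: "flower P \<Longrightarrow> displays P X \<Longrightarrow> displays P (E - X)"
  using flower_petal(3)[of P] by (auto simp: displays_iff)

text \<open>If a displayed separation has \<open>x\<close> and \<open>y\<close> on different sides,
  \<open>x\<close> can be moved to the side of \<open>y\<close> in two weak pieces, \<open>A\<close>
  and then \<open>x - A\<close>. Merging the two petals therefore loses no class of
  separations.\<close>

lemma merge_not_tight:
  assumes f: "flower (x # y # zs)" and t: "tight (x # y # zs)"
    and A: "A \<subseteq> x" "wk A" "wk (x - A)" "sep (A \<union> y)"
  shows False
proof (rule tight_contradiction[OF t flower_merge[OF f]])
  note f' = flower_merge[OF f]
  show "length ((x \<union> y) # zs) < length (x # y # zs)" by simp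
  show "displays (x # y # zs) X" if "displays ((x \<union> y) # zs) X" for X
    using that unfolding displays_iff[OF f] displays_iff[OF f'] by auto
  have sxy: "st x" "st y" using flower_petal(1)[OF f] by auto
  have pxy: "sep (x \<union> y)" using flower_petal(2)[OF f'] by simp
  have move: "equi V (V \<union> x) \<and> kS (V \<union> x)" if V: "kS V" "y \<subseteq> V" "x \<inter> V = {}" for V
  proof -
    note v = kS_D[OF V(1)]
    have sy: "st (E - y)"
      by (rule strong_mono[OF sxy(1)]) (use V strong_subset[OF sxy(1)] in auto)
    \<comment> \<open>Both uncrossings go through \<open>y\<close>, whose complement is strong
      because it contains \<open>x\<close>.\<close>
    have "V \<inter> (A \<union> y) = y" "V \<union> (A \<union> y) = V \<union> A" using V A(1) by auto
    then have "sep (V \<union> A)" using sep_Un[OF sksepD(1)[OF v(2)] A(4)] sy sxy(2) by simp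
    note m1 = kS_weak_extension[OF V(1) A(2) this]
    have "V \<inter> (x \<union> y) = y" "V \<union> (x \<union> y) = V \<union> x" using V by auto
    then have "sep (V \<union> x)" using sep_Un[OF sksepD(1)[OF v(2)] pxy] sy sxy(2) by simp
    moreover have "V \<union> A \<union> (x - A) = V \<union> x" using A(1) by blast
    ultimately have "equi (V \<union> A) (V \<union> x)" "kS (V \<union> x)"
      using kS_weak_extension[OF m1(2) A(3)] by simp_all
    then show ?thesis using T_equiv_trans[OF m1(1)] by blast
  qed
  show "\<exists>X'. kS X' \<and> displays ((x \<union> y) # zs) X' \<and> equi X X'"
    if X: "kS X" "displays (x # y # zs) X" for X
  proof -
    note xx = kS_D[OF X(1)]
    have step: "\<exists>X'. kS X' \<and> displays ((x \<union> y) # zs) X' \<and> equi V X'"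
      if V: "kS V" "displays (x # y # zs) V" "y \<subseteq> V" "x \<inter> V = {}" for V
    proof -
      have "x \<inter> \<Union>(set zs) = {}" using flower_append_disjoint[of "[x]" "y # zs"] f by auto
      then have "z \<inter> x = {}" if "z \<in> set zs" for z using that by blast
      then have "displays ((x \<union> y) # zs) (V \<union> x)"
        using V(2,3) flower_petal(3)[OF f, of x]
        unfolding displays_iff[OF f] displays_iff[OF f'] by (auto simp: Int_Un_distrib)
      then show ?thesis using move[OF V(1,3,4)] by blast
    qed
    have d: "X \<subseteq> E" "x \<subseteq> X \<or> x \<inter> X = {}" "y \<subseteq> X \<or> y \<inter> X = {}"
      using X(2) unfolding displays_iff[OF f] by auto
    consider "x \<union> y \<subseteq> X \<or> (x \<union> y) \<inter> X = {}" | "y \<subseteq> X" "x \<inter> X = {}" | "x \<subseteq> X" "y \<inter> X = {}"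
      using d(2,3) by blast
    then show ?thesis
    proof cases
      case 1
      then have "displays ((x \<union> y) # zs) X"
        using X(2) unfolding displays_iff[OF f] displays_iff[OF f'] by simp
      then show ?thesis using X(1) T_equiv_refl[OF xx(2)] by blast
    next
      case 2
      then show ?thesis using step X by blast
    next
      case 3
      have "y \<subseteq> E - X" "x \<inter> (E - X) = {}" using 3 flower_petal(3)[OF f, of y] by auto
      then obtain X' where "kS X'" "displays ((x \<union> y) # zs) X'" "equi (E - X) X'"
        using step[OF xx(5) displays_compl[OF f X(2)]] by blast
      then show ?thesis using T_equiv_trans[OF T_equiv_compl[OF xx(2)]] by blast
    qed
  qed
qed

text \<open>The strong red in \<open>ys\<close> and strong green in \<open>zs\<close> make
  \<open>R \<inter> x\<close> together with the arc \<open>ys\<close> k-separating. Intersecting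
  with \<open>x \<union> y\<close>, for \<open>y\<close> the first petal of the arc, leaves
  \<open>R \<inter> x \<union> y\<close>, and \<open>merge_not_tight\<close> applies.\<close>

lemma cut_not_tight:
  assumes f: "flower (x # ys @ zs)" and t: "tight (x # ys @ zs)" and R: "sksep R"
    and ys: "ys \<noteq> []" and w: "wk (R \<inter> x)" "wk (x - R)"
    and s: "st (R \<inter> \<Union>(set ys))" "st (\<Union>(set zs) - R)"
  shows False
proof -
  obtain y ys' where y: "ys = y # ys'" using ys by (cases ys) auto
  let ?Y = "\<Union>(set ys)" and ?Z = "\<Union>(set zs)"
  have f2: "flower (ys @ zs @ [x])" using flower_rotate[of "[x]" "ys @ zs"] f by simp
  have sY: "sep ?Y" using flower_arc_sep[OF f2 ys] .
  have sxY: "sep (x \<union> ?Y)" using flower_arc_sep[of "x # ys" zs] f by simp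
  have sxy: "sep (x \<union> y)" using flower_arc_sep[of "[x, y]" "ys' @ zs"] f y by simp
  have dis: "(x \<union> ?Y) \<inter> ?Z = {}" "x \<inter> ?Y = {}"
    using flower_append_disjoint[of "x # ys" zs] flower_append_disjoint[of "[x]" "ys @ zs"] f by auto
  have "x \<union> ?Y \<union> ?Z = E" using flower_Union[OF f] by auto
  then have Z: "E - R - (x \<union> ?Y) = ?Z - R" "E - (x \<union> ?Y) = ?Z" "x \<union> ?Y \<subseteq> E" using dis by auto
  have 1: "sep (R \<inter> x \<union> ?Y)" using sep_Int_Un_adjacent[OF R sY sxY s(1)] s(2) Z(1) by simp
  have "(R \<inter> x \<union> ?Y) \<inter> (x \<union> y) = R \<inter> x \<union> y" "(R \<inter> x \<union> ?Y) \<union> (x \<union> y) = x \<union> ?Y"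
    using dis(2) y by auto
  moreover have "st (x \<union> ?Y)"
    by (rule strong_mono[of x]) (use flower_petal(1)[OF f] Z(3) in auto)
  moreover have "st ?Z" by (rule strong_mono[OF s(2)]) (use Z(2) in auto)
  ultimately have "sep (R \<inter> x \<union> y)" using sep_Int[OF 1 sxy] Z(2) by simp
  moreover have "x - R \<inter> x = x - R" by blast
  ultimately show False
    using merge_not_tight[of x y "ys' @ zs" "R \<inter> x"] f t w y by simp
qed

text \<open>Green comes from \<open>cut_not_tight\<close> for \<open>R\<close>, red from the same
  lemma for \<open>E - R\<close>.\<close>

lemma cut_weak:
  assumes f: "flower (x # ys @ zs)" and t: "tight (x # ys @ zs)" and R: "sksep R"
    and ys: "ys \<noteq> []" and w: "wk (R \<inter> x)" "wk (x - R)"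
    and s: "st (R \<inter> \<Union>(set ys))" "st (\<Union>(set ys) - R)"
  shows "wk (R \<inter> \<Union>(set zs))" "wk (\<Union>(set zs) - R)"
proof -
  have U: "E = x \<union> \<Union>(set ys) \<union> \<Union>(set zs)" using flower_Union[OF f] by auto
  have sub: "x \<subseteq> E" "\<Union>(set ys) \<subseteq> E" "\<Union>(set zs) \<subseteq> E" unfolding U by blast+
  have e: "(E - R) \<inter> X = X - R" "X - (E - R) = R \<inter> X" if "X \<subseteq> E" for X using that by auto
  show "wk (\<Union>(set zs) - R)"
    using cut_not_tight[OF f t R ys w s(1)] sub(3) strong_iff[of "\<Union>(set zs) - R"] by blast
  have "\<not> st (R \<inter> \<Union>(set zs))"
    using cut_not_tight[OF f t sksep_compl[OF R] ys] w s unfolding e[OF sub(1)] e[OF sub(2)] e[OF sub(3)]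
    by blast
  then show "wk (R \<inter> \<Union>(set zs))" using sub(3) strong_iff[of "R \<inter> \<Union>(set zs)"] by blast
qed

text \<open>Uncrossing makes \<open>U - R\<close> k-separating, so \<open>U\<close> would be
  sequential as a union of two weak sets.\<close>

lemma kS_not_weak_pair:
  assumes "kS U" "sksep R" "wk (R \<inter> U)" "wk (U - R)" "st (R - U)"
  shows False
proof -
  note u = kS_D[OF assms(1)] sksepD[OF kS_D(2)[OF assms(1)]]
  have "sep (U - R)" using sep_Int_compl_crossing[OF assms(2) u(6) assms(5)] .
  then have "cl (E - U) = E"
    using fcl_compl_of_weak_pair[of U "R \<inter> U" "U - R"] u assms by blast
  then show False using u(4) by blast
qed

subsection \<open>Petals with two weak colour classes\<close>

text \<open>A strong petal with two weak classes is bichromatic, hence so is every \<open>U\<close>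
  around it, and the monochromatic alternatives in \<open>settled\<close> fall away.\<close>

lemma settled_displayed:
  assumes "settled R P" "sep U" "displays P U" "r \<subseteq> U" "wk (R \<inter> r)" "wk (r - R)" "st r"
  shows "(wk (R \<inter> U) \<and> wk (U - R)) \<or> (st (R \<inter> U) \<and> st (U - R))"
proof -
  have "R \<inter> r \<noteq> {}"
  proof
    assume "R \<inter> r = {}"
    then have "r - R = r" by blast
    then show False using assms(6,7) by (simp add: strong_def)
  qed
  moreover have "r - R \<noteq> {}"
  proof
    assume "r - R = {}"
    then have "R \<inter> r = r" by blast
    then show False using assms(5,7) by (simp add: strong_def)
  qed
  ultimately have "R \<inter> U \<noteq> {}" "U - R \<noteq> {}" using assms(4) by blast+
  then have "wk (R \<inter> U) \<longleftrightarrow> wk (U - R)"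
    using assms(1)[unfolded settled_def, rule_format, OF assms(2,3)] by blast
  moreover have "R \<inter> U \<subseteq> E" "U - R \<subseteq> E" using sep_subset[OF assms(2)] by auto
  ultimately show ?thesis using strong_iff by simp
qed

text \<open>All petals have two weak colour classes: cutting the remaining petals at the first place where
  a prefix becomes strong covers \<^term>\<open>E\<close> by eight weak sets.\<close>

lemma all_petals_weak_not_tight:
  assumes f: "flower (p # xs)" and t: "tight (p # xs)" and R: "kS R" and set: "settled R (p # xs)"
    and w: "\<And>q. q \<in> set (p # xs) \<Longrightarrow> wk (R \<inter> q) \<and> wk (q - R)"
  shows False
proof -
  define W where "W ys \<longleftrightarrow> wk (R \<inter> \<Union>(set ys)) \<and> wk (\<Union>(set ys) - R)" for ys
  have "W []" using weak_mono[of "R \<inter> p" "{}"] w[of p] unfolding W_def by simp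
  have E: "E = p \<union> \<Union>(set xs)" using flower_Union[OF f] by simp
  have "\<not> W xs"
  proof
    assume "W xs"
    then have "\<forall>x\<in>set [R \<inter> p, p - R, R \<inter> \<Union>(set xs), \<Union>(set xs) - R]. wk x"
      using w[of p] unfolding W_def by simp
    then show False using weak_no_cover E by fastforce
  qed
  then have "\<exists>ys q zs. xs = ys @ q # zs \<and> W ys \<and> \<not> W (ys @ [q])"
  proof (induction xs rule: rev_induct)
    case (snoc x xs)
    then show ?case by (cases "W xs") force+
  qed (use \<open>W []\<close> in simp)
  then obtain ys q zs where xs: "xs = ys @ q # zs" and W: "W ys" "\<not> W (ys @ [q])" by blast
  let ?Y = "\<Union>(set (ys @ [q]))"
  have f2: "flower ((ys @ [q]) @ (zs @ [p]))" using flower_rotate[of "[p]" xs] f xs by simp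
  have "sep ?Y" using flower_arc_sep[OF f2] by simp
  moreover have "displays (p # xs) ?Y" by (rule displays_Union_petals) (use xs in auto)
  moreover have "q \<in> set (p # xs)" "q \<subseteq> ?Y" using xs by auto
  \<comment> \<open>Both classes turn strong at the same petal \<open>q\<close>, so
    \<open>cut_weak\<close> at \<open>p\<close> makes everything after \<open>q\<close> weak in both
    colours.\<close>
  ultimately have s: "st (R \<inter> ?Y)" "st (?Y - R)"
    using settled_displayed[OF set, of ?Y q] w[of q] flower_petal(1)[OF f, of q] W(2)
    unfolding W_def by blast+
  have "flower (p # (ys @ [q]) @ zs)" "tight (p # (ys @ [q]) @ zs)" using f t xs by simp_all
  from cut_weak[OF this kS_D(2)[OF R] _ _ _ s] have
    "wk (R \<inter> \<Union>(set zs))" "wk (\<Union>(set zs) - R)" using w[of p] by simp_all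
  then have weak: "\<forall>x\<in>set [R \<inter> p, p - R, R \<inter> \<Union>(set ys), \<Union>(set ys) - R, R \<inter> q, q - R,
      R \<inter> \<Union>(set zs), \<Union>(set zs) - R]. wk x"
    using w[of p] w[of q] W(1) xs unfolding W_def by simp
  have cover: "E \<subseteq> \<Union>(set [R \<inter> p, p - R, R \<inter> \<Union>(set ys), \<Union>(set ys) - R, R \<inter> q, q - R,
      R \<inter> \<Union>(set zs), \<Union>(set zs) - R])" unfolding E xs by auto
  show False by (rule notE[OF weak_no_cover[OF weak] cover]) simp_all
qed

text \<open>If only the petal \<^term>\<open>q\<close> has strong colour classes, every displayed separation that
  counts is equivalent to the one displayed by \<^term>\<open>q\<close> alone.\<close>

lemma one_strong_petal_not_tight:
  assumes f: "flower (w # q # y # ms)" and t: "tight (w # q # y # ms)" and R: "kS R"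
    and set: "settled R (w # q # y # ms)"
    and sq: "st (R \<inter> q)" "st (q - R)"
    and wy: "wk (R \<inter> \<Union>(set (y # ms)))" "wk (\<Union>(set (y # ms)) - R)"
    and ww: "wk (R \<inter> \<Union>(set (w # ms)))" "wk (\<Union>(set (w # ms)) - R)"
  shows False
proof -
  let ?P = "w # q # y # ms" and ?P' = "[E - q, q]"
  note r = kS_D[OF R]
  have U: "E = w \<union> q \<union> y \<union> \<Union>(set ms)" using flower_Union[OF f] by auto
  have fr: "flower ([q] @ (y # ms @ [w]))"
    using flower_rotate[of "[w]" "q # y # ms"] f by simp
  have d: "q \<inter> (y \<union> \<Union>(set ms) \<union> w) = {}" using flower_append_disjoint[OF fr] by auto
  have Eq: "E - q = w \<union> y \<union> \<Union>(set ms)" using U d by blast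
  have pq: "sep q" "st q" "q \<subseteq> E" "st w" using flower_petal[OF f] by auto
  have "st (E - q)" unfolding Eq
    by (rule strong_mono[OF pq(4)]) (use flower_Union[OF f] in auto)
  then have f': "flower ?P'" unfolding flower_Cons_iff
    using pq sep_compl[OF pq(1)] sep_whole[OF pq(1)] by (auto simp: Un_absorb2 Un_commute)
  have disj: "p = q \<or> p \<inter> q = {}" if "p \<in> set ?P" for p
    using flower_disjoint[OF f, of p q] that by auto
  have sR: "sep (R - q)"
  proof -
    have "R \<inter> (E - q) = R - q" "E - R - (E - q) = q - R" using r(1) pq(3) by auto
    then show ?thesis using sep_Int_crossing[OF r(2) sep_compl[OF pq(1)]] sq(2) by simp
  qed
  \<comment> \<open>It suffices to treat the side avoiding \<open>q\<close>; the other case passes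
    to the complement.\<close>
  have key: "equi U (E - q) \<and> kS (E - q)"
    if V: "kS U" "displays ?P U" "q \<inter> U = {}" for U
  proof -
    note u = kS_D[OF V(1)] sksepD[OF kS_D(2)[OF V(1)]]
    have dis: "\<And>p. p \<in> set ?P \<Longrightarrow> p \<subseteq> U \<or> p \<inter> U = {}" using V(2) unfolding displays_iff[OF f] by blast
    have "wk {}" using weak_mono[OF wy(1)] by blast
    then have "U \<noteq> {}" using u(7) unfolding strong_def by blast
    then obtain x where x: "x \<in> U" by blast
    then have "x \<in> \<Union>(set ?P)" using u(1) flower_Union[OF f] by auto
    then obtain p where p: "p \<in> set ?P" "x \<in> p" by blast
    then have pU: "p \<subseteq> U" using dis[OF p(1)] x by blast
    have "p \<noteq> q" using x p(2) V(3) by blast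
    then have "p \<in> set (w # ms) \<or> p \<in> set (y # ms)" using p(1) by auto
    then have wp: "wk (R \<inter> p) \<and> wk (p - R)"
    proof
      assume "p \<in> set (w # ms)"
      then have "R \<inter> p \<subseteq> R \<inter> \<Union>(set (w # ms))" "p - R \<subseteq> \<Union>(set (w # ms)) - R" by blast+
      then show ?thesis using weak_mono ww by metis
    next
      assume "p \<in> set (y # ms)"
      then have "R \<inter> p \<subseteq> R \<inter> \<Union>(set (y # ms))" "p - R \<subseteq> \<Union>(set (y # ms)) - R" by blast+
      then show ?thesis using weak_mono wy by metis
    qed
    have "st (R - U)" by (rule strong_mono[OF sq(1)]) (use V(3) r(1) in auto)
    \<comment> \<open>The strong class \<open>R \<inter> q\<close> lies outside \<open>U\<close>, so
      two weak classes would make \<open>U\<close> sequential.\<close>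
    then have "\<not> (wk (R \<inter> U) \<and> wk (U - R))" using kS_not_weak_pair[OF V(1) r(2)] by blast
    then have s: "st (R \<inter> U)" "st (U - R)"
      using settled_displayed[OF set u(6) V(2) pU] wp flower_petal(1)[OF f p(1)] by blast+
    have UEq: "U \<subseteq> E - q" using V(3) u(1) by blast
    \<comment> \<open>Otherwise \<open>U\<close> lies within \<open>ms\<close>, whose red part is
      weak. Once \<open>U\<close> contains one of the two, what it misses outside \<open>q\<close>
      lies in one of the arcs known to be weak in both colours, and is added red first, then
      green.\<close>
    have "w \<subseteq> U \<or> y \<subseteq> U"
    proof (rule ccontr)
      assume "\<not> ?thesis"
      then have "w \<inter> U = {}" "y \<inter> U = {}" using dis[of w] dis[of y] by simp_all
      then have "U \<subseteq> \<Union>(set ms)" using UEq unfolding Eq by blast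
      then have "R \<inter> U \<subseteq> R \<inter> \<Union>(set (w # ms))" by auto
      then have "wk (R \<inter> U)" using weak_mono[OF ww(1)] by blast
      then show False using s(1) unfolding strong_def by blast
    qed
    then have rest: "wk (R - q - U) \<and> wk (E - q - U - R)"
    proof
      assume "w \<subseteq> U"
      then have i: "E - q - U \<subseteq> \<Union>(set (y # ms))" unfolding Eq by auto
      have "R - q - U \<subseteq> R \<inter> \<Union>(set (y # ms))" "E - q - U - R \<subseteq> \<Union>(set (y # ms)) - R"
        using i r(1) by blast+
      then show ?thesis using weak_mono wy by metis
    next
      assume "y \<subseteq> U"
      then have i: "E - q - U \<subseteq> \<Union>(set (w # ms))" unfolding Eq by auto
      have "R - q - U \<subseteq> R \<inter> \<Union>(set (w # ms))" "E - q - U - R \<subseteq> \<Union>(set (w # ms)) - R"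
        using i r(1) by blast+
      then show ?thesis using weak_mono ww by metis
    qed
    have "U \<inter> (R - q) = R \<inter> U" using V(3) by blast
    moreover have "st (E - R \<inter> U)" by (rule strong_mono[OF pq(2)]) (use V(3) pq(3) in auto)
    ultimately have "sep (U \<union> (R - q))" using sep_Un[OF u(6) sR] s(1) by simp
    moreover have "U \<union> (R - q - U) = U \<union> (R - q)" by blast
    ultimately have m1: "equi U (U \<union> (R - q))" "kS (U \<union> (R - q))"
      using kS_weak_extension[OF V(1) rest[THEN conjunct1]] by simp_all
    have "U \<union> (R - q) \<union> (E - q - U - R) = E - q" using UEq r(1) by blast
    then have "equi (U \<union> (R - q)) (E - q)" "kS (E - q)"
      using kS_weak_extension[OF m1(2) rest[THEN conjunct2]] sep_compl[OF pq(1)] by simp_all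
    then show ?thesis using T_equiv_trans[OF m1(1)] by blast
  qed
  show False
  proof (rule tight_contradiction[OF t f'])
    show "length ?P' < length ?P" by simp
    show "displays ?P X" if "displays ?P' X" for X
    proof -
      have X: "X \<subseteq> E" "q \<subseteq> X \<or> q \<inter> X = {}" "E - q \<subseteq> X \<or> (E - q) \<inter> X = {}"
        using that unfolding displays_iff[OF f'] by auto
      have "p \<subseteq> X \<or> p \<inter> X = {}" if "p \<in> set ?P" for p
      proof (cases "p = q")
        case False
        then have "p \<subseteq> E - q" using disj[OF that] flower_petal(3)[OF f that] by blast
        then show ?thesis using X(3) by blast
      qed (use X in simp)
      then show ?thesis unfolding displays_iff[OF f] using X(1) by blast
    qed
    have dq: "displays ?P' (E - q)" unfolding displays_iff[OF f'] by auto
    show "\<exists>X'. kS X' \<and> displays ?P' X' \<and> equi X X'" if X: "kS X" "displays ?P X" for X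
    proof -
      note xx = kS_D[OF X(1)]
      have "q \<in> set ?P" by simp
      then have "q \<subseteq> X \<or> q \<inter> X = {}" using X(2) unfolding displays_iff[OF f] by blast
      then have "equi X (E - q) \<and> kS (E - q)"
      proof
        assume "q \<subseteq> X"
        then have "q \<inter> (E - X) = {}" by blast
        then show ?thesis
          using key[OF xx(5) displays_compl[OF f X(2)]] T_equiv_trans[OF T_equiv_compl[OF xx(2)]] by blast
      qed (use key[OF X] in blast)
      then show ?thesis using dq by blast
    qed
  qed
qed

text \<open>Since \<open>R\<close> is settled on \<open>w \<union> q\<close>, both classes there are
  strong, which forces \<open>q\<close> to be bichromatic with two strong classes. Cutting from
  either neighbour of \<open>q\<close> then gives the weak arcs of
  \<open>one_strong_petal_not_tight\<close>.\<close>

lemma mixed_petals_not_tight: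
  assumes f: "flower (w # q # rest)" and t: "tight (w # q # rest)" and R: "kS R"
    and set: "settled R (w # q # rest)"
    and w: "wk (R \<inter> w)" "wk (w - R)" and q: "\<not> (wk (R \<inter> q) \<and> wk (q - R))"
  shows False
proof -
  let ?P = "w # q # rest"
  note r = kS_D[OF R]
  have swq: "st w" "st q" "sep q" "w \<subseteq> E" "q \<subseteq> E" using flower_petal[OF f] by auto
  have "sep (w \<union> q)" using flower_arc_sep[of "[w, q]" rest] f by simp
  moreover have "displays ?P (w \<union> q)" using displays_Union_petals[of "[w, q]" ?P] by simp
  ultimately have wq: "(wk (R \<inter> (w \<union> q)) \<and> wk (w \<union> q - R)) \<or> (st (R \<inter> (w \<union> q)) \<and> st (w \<union> q - R))"
    using settled_displayed[OF set, of "w \<union> q" w] w swq(1) by blast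
  have "\<not> (wk (R \<inter> (w \<union> q)) \<and> wk (w \<union> q - R))"
  proof
    assume "wk (R \<inter> (w \<union> q)) \<and> wk (w \<union> q - R)"
    moreover have "R \<inter> q \<subseteq> R \<inter> (w \<union> q)" "q - R \<subseteq> w \<union> q - R" by auto
    ultimately show False using weak_mono q by metis
  qed
  then have wq': "\<not> wk (R \<inter> (w \<union> q))" "\<not> wk (w \<union> q - R)" using wq unfolding strong_def by auto
  have "R \<inter> q \<noteq> {}"
  proof
    assume "R \<inter> q = {}"
    then have "R \<inter> (w \<union> q) = R \<inter> w" by blast
    then show False using wq'(1) w by simp
  qed
  moreover have "q - R \<noteq> {}"
  proof
    assume "q - R = {}"
    then have "w \<union> q - R = w - R" by blast
    then show False using wq'(2) w by simp
  qed
  moreover have "displays ?P q" using displays_Union_petals[of "[q]" ?P] by simp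
  ultimately have "wk (R \<inter> q) \<longleftrightarrow> wk (q - R)"
    using set[unfolded settled_def, rule_format, OF swq(3)] by blast
  moreover have "R \<inter> q \<subseteq> E" "q - R \<subseteq> E" using swq(5) by auto
  ultimately have sq: "st (R \<inter> q)" "st (q - R)" using q strong_iff by auto
  show False
  proof (cases rest)
    case Nil
    have E: "E = w \<union> q" "w \<inter> q = {}"
      using flower_Union[OF f] flower_append_disjoint[of "[w]" "[q]"] f Nil by auto
    have "st (R - w)" by (rule strong_mono[OF sq(1)]) (use E r(1) in auto)
    then have "sep (w - R)" using sep_Int_compl_crossing[OF r(2)] flower_petal(2)[OF f] by simp
    \<comment> \<open>With only two petals, the adjacency needed for merging is a
      complement.\<close>
    moreover have "E - (w - R) = R \<inter> w \<union> q" using E by auto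
    ultimately have "sep (R \<inter> w \<union> q)" using sep_compl by metis
    moreover have "w - R \<inter> w = w - R" by blast
    ultimately show False using merge_not_tight[OF f t, of "R \<inter> w"] w by simp
  next
    case (Cons y ms)
    have f1: "flower (w # [q] @ (y # ms))" and t1: "tight (w # [q] @ (y # ms))" using f t Cons by simp_all
    have wy: "wk (R \<inter> \<Union>(set (y # ms)))" "wk (\<Union>(set (y # ms)) - R)"
      using cut_weak[OF f1 t1 r(2) _ w] sq by simp_all
    have "R \<inter> y \<subseteq> R \<inter> \<Union>(set (y # ms))" "y - R \<subseteq> \<Union>(set (y # ms)) - R" by auto
    then have y: "wk (R \<inter> y)" "wk (y - R)" using weak_mono wy by metis+
    \<comment> \<open>The petal \<open>y\<close> also has two weak classes, so the cut can be
      repeated from it in the reversed cyclic order.\<close>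
    have "flower (rev ms @ [y, q, w])" using flower_rev[OF f1] by simp
    then have "flower ([y, q, w] @ rev ms)" using flower_rotate by blast
    then have f2: "flower (y # [q] @ (w # rev ms))" by simp
    have t2: "tight (y # [q] @ (w # rev ms))" by (rule tight_cong[OF t1]) auto
    have "wk (R \<inter> \<Union>(set (w # ms)))" "wk (\<Union>(set (w # ms)) - R)"
      using cut_weak[OF f2 t2 r(2) _ y] sq by simp_all
    then show False
      using one_strong_petal_not_tight[of w q y ms R] f t R set sq wy Cons by simp
  qed
qed

lemma settled_cong: "set P = set Q \<Longrightarrow> settled R P \<longleftrightarrow> settled R Q"
  unfolding settled_def using displays_cong by metis

lemma weak_petal_not_tight:
  assumes f: "flower P" and t: "tight P" and R: "kS R" and set: "settled R P"
    and p: "p \<in> set P" "wk (R \<inter> p)" "wk (p - R)"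
  shows False
proof -
  define W where "W q \<longleftrightarrow> wk (R \<inter> q) \<and> wk (q - R)" for q
  obtain xs ys where P: "P = xs @ p # ys" using p(1) by (meson split_list)
  define zs where "zs = ys @ xs"
  have f1: "flower (p # zs)" using flower_rotate[of xs "p # ys"] f P zs_def by simp
  have t1: "tight (p # zs)" by (rule tight_cong[OF t]) (auto simp: P zs_def)
  have set1: "settled R (p # zs)" using settled_cong[of P "p # zs"] set P zs_def by auto
  show False
  proof (cases "\<forall>q\<in>set zs. W q")
    case True
    then show False using all_petals_weak_not_tight[OF f1 t1 R set1] p unfolding W_def by auto
  next
    case False
    then obtain us q vs where zs: "zs = us @ q # vs" "\<not> W q" "\<forall>u\<in>set us. W u"
      using split_list_first_prop[of zs "\<lambda>q. \<not> W q"] by auto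
    \<comment> \<open>The petal \<open>w\<close> directly precedes the first petal \<open>q\<close>
      that is not weak in both colours; it is \<open>p\<close> itself if \<open>us\<close> is
      empty.\<close>
    obtain ws w where w: "p # us = ws @ [w]" by (metis rev_exhaust list.distinct(1))
    have "w \<in> set (p # us)" unfolding w by simp
    then have Ww: "W w" using zs(3) p unfolding W_def by auto
    have e: "p # zs = ws @ (w # q # vs)" using w zs(1)
      by (metis append.assoc append_Cons append_Nil)
    have f2: "flower (w # q # vs @ ws)" using flower_rotate[of ws "w # q # vs"] f1 e by simp
    have "set (p # zs) = set (w # q # vs @ ws)" "length (p # zs) = length (w # q # vs @ ws)"
      unfolding e by auto
    then have "tight (w # q # vs @ ws)" "settled R (w # q # vs @ ws)"
      using tight_cong[OF t1] set1 settled_cong by blast+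
    then show False using mixed_petals_not_tight[OF f2 _ R] Ww zs(2) unfolding W_def by blast
  qed
qed

theorem kS_conforms:
  assumes f: "flower P" and t: "tight P" and m: "S_maximal E lam k T S P" and R0: "kS R0"
  shows "conforms E lam k T P R0"
proof -
  obtain R where R: "kS R" "equi R0 R" "settled R P" using exists_settled[OF f R0] by blast
  note r = kS_D[OF R(1)]
  show ?thesis
  proof (cases "\<exists>p\<in>set P. R \<subseteq> p \<or> E - R \<subseteq> p")
    \<comment> \<open>This is the second alternative of \<open>conforms\<close>; its failure is what
      \<open>flower_refine\<close> requires, and it also excludes a flower with a single
      petal.\<close>
    case True
    then have "\<exists>i<length P. R \<subseteq> P!i \<or> E - R \<subseteq> P!i" by (metis in_set_conv_nth)
    then show ?thesis unfolding conforms_def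
      using R(2) sksepD(1)[OF r(2)] kS_D(2)[OF R0] by blast
  next
    case False
    have "P \<noteq> []"
    proof
      assume "P = []"
      then have "E = {}" using flower_Union[OF f] by simp
      then show False using r(3) fcl_subset[of R] by simp
    qed
    moreover have "P \<noteq> [p]" for p using False r(1) flower_Union[OF f] by auto
    ultimately have len: "length P \<ge> 2" by (cases P; cases "tl P") auto
    have pt: "(R \<inter> q = {} \<or> st (R \<inter> q)) \<and> (q - R = {} \<or> st (q - R))" if q: "q \<in> set P" for q
    proof -
      have qq: "st q" "sep q" "q \<subseteq> E" using flower_petal[OF f q] by auto
      have "displays P q" using displays_Union_petals[of "[q]" P] q by simp
      then have "R \<inter> q = {} \<or> q - R = {} \<or> (wk (R \<inter> q) \<longleftrightarrow> wk (q - R))"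
        using R(3)[unfolded settled_def, rule_format, OF qq(2)] by blast
      moreover have "\<not> (wk (R \<inter> q) \<and> wk (q - R))"
        using weak_petal_not_tight[OF f t R(1,3) q] by blast
      moreover have "st (R \<inter> q) \<longleftrightarrow> \<not> wk (R \<inter> q)" "st (q - R) \<longleftrightarrow> \<not> wk (q - R)"
        using qq(3) by (auto intro!: strong_iff)
      moreover have "q - R = q" if "R \<inter> q = {}" using that by blast
      moreover have "R \<inter> q = q" if "q - R = {}" using that by blast
      ultimately show ?thesis using qq(1) by metis
    qed
    obtain P' where P': "flower P'" "displays P' R" "\<And>U. displays P U \<Longrightarrow> displays P' U"
      using flower_refine[OF f len r(2) pt] False by blast
    have "flower_le E lam k T S P P'" unfolding flower_le_def
      using P'(3) T_equiv_refl kS_D(2) by blast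
    then have "flower_le E lam k T S P' P" using m P'(1) unfolding S_maximal_def by blast
    then obtain X where X: "kS X" "displays P X" "equi R X"
      using R(1) P'(2) unfolding flower_le_def by blast
    then show ?thesis unfolding conforms_def
      using T_equiv_trans[OF R(2)] sksepD(1)[OF kS_D(2)[OF X(1)]] kS_D(2)[OF R0] by blast
  qed
qed

end

theorem theorem5p10:
  fixes E :: "'a set" and lam :: "'a set \<Rightarrow> int" and k :: int
    and T :: "'a set set" and S :: "'a set set" and P :: "'a set list"
  assumes "connectivity_system E lam"
    and "robust_tangle E lam k T"
    and "tree_compatible E lam k T S"
    and "k_flower E lam k T P"
    and "S_tight E lam k T S P"
    and "S_maximal E lam k T S P"
  shows "\<forall>R. kS_sep E lam k S R \<longrightarrow> conforms E lam k T P R"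
proof -
  interpret tree_compatible_set E lam k T S using assms(1-3) by unfold_locales
  show ?thesis using kS_conforms assms(4-6) by blast
qed

end
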